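(* Let $H=(V,E)$ be a directed hypergraph on $n$ vertices with $m$ hyperedges, and let $r$ be the maximum size of a hyperedge of $H$. Then one can compute, in time $O(mr^2)$, an undirected hypergraph $\psi(H)$ on $n^2+1$ vertices, and for every $x\in\mathbb{R}^n$ one can compute, in time $O(n^2)$, a vector $\vartheta(x)\in\mathbb{R}^{n^2+1}$, such that for every $x\in\mathbb{R}^n$ \[ x^T L_H x=\vartheta(x)^T L_{\psi(H)}\vartheta(x). \] Moreover, for every hyperedge $e$ of $H$ there is a single corresponding hyperedge $\psi(e)$ of $\psi(H)$ such that for every $x\in\mathbb{R}^n$, $x^T L_e x=\vartheta(x)^T L_{\psi(e)}\vartheta(x)$, where $L_e$ and $L_{\psi(e)}$ denote the quadratic forms of the single-hyperedge hypergraphs; the size of $\psi(e)$ is at most $|e|^2$. Further, if $x\in\{0,1\}^n$ then $\vartheta(x)\in\{0,1\}^{n^2+1}$.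
   Context: A directed hypergraph $H=(V,E)$ consists of a vertex set $V$ and directed hyperedges $e=(L(e),R(e))$ with $L(e)=e_{\text{tail}}\subseteq V$, $R(e)=e_{\text{head}}\subseteq V$ (not necessarily disjoint), each with a nonnegative weight $w_e$. For $x\in\mathbb{R}^V$ its directed Laplacian quadratic form is $x^T L_H x=\sum_{e\in E} w_e\max_{u\in L(e),v\in R(e)}(x_u-x_v)_+^2$ where $(a)_+=\max(a,0)$. An undirected hypergraph $G=(V,E)$ has hyperedges $e\subseteq V$ with nonnegative weights $w_e$, and $x^T L_G x=\sum_{e\in E} w_e\max_{u,v\in e}(x_u-x_v)^2$. *)

theory Defs
  imports Complex_Main
begin

section \<open>Weighted hypergraphs and their Laplacian quadratic forms\<close>

text \<open>A directed hyperedge is the pair of its tail and its head.\<close>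

type_synonym 'v dhyperedge = "'v set \<times> 'v set"

record 'v dhypergraph =
  dverts :: "'v set"
  dedges :: "'v dhyperedge set"
  dweight :: "'v dhyperedge \<Rightarrow> real"

record 'v hypergraph =
  verts :: "'v set"
  edges :: "'v set set"
  weight :: "'v set \<Rightarrow> real"

text \<open>Tails, heads and undirected hyperedges are nonempty, as the maxima in the quadratic
  forms range over them.\<close>

definition directed_hypergraph :: "'v dhypergraph \<Rightarrow> bool" where
  "directed_hypergraph H \<longleftrightarrow> finite (dverts H) \<and>
     (\<forall>(L, R)\<in>dedges H. L \<subseteq> dverts H \<and> R \<subseteq> dverts H \<and> L \<noteq> {} \<and> R \<noteq> {}) \<and>
     (\<forall>e\<in>dedges H. 0 \<le> dweight H e)"

definition undirected_hypergraph :: "'v hypergraph \<Rightarrow> bool" where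
  "undirected_hypergraph G \<longleftrightarrow> finite (verts G) \<and>
     (\<forall>e\<in>edges G. e \<subseteq> verts G \<and> e \<noteq> {}) \<and>
     (\<forall>e\<in>edges G. 0 \<le> weight G e)"

definition dlaplacian_form :: "'v dhypergraph \<Rightarrow> ('v \<Rightarrow> real) \<Rightarrow> real" where
  "dlaplacian_form H x =
     (\<Sum>(L, R)\<in>dedges H. dweight H (L, R) * Max {(max (x u - x v) 0)\<^sup>2 | u v. u \<in> L \<and> v \<in> R})"

definition laplacian_form :: "'v hypergraph \<Rightarrow> ('v \<Rightarrow> real) \<Rightarrow> real" where
  "laplacian_form G x =
     (\<Sum>e\<in>edges G. weight G e * Max {(x u - x v)\<^sup>2 | u v. u \<in> e \<and> v \<in> e})"

text \<open>The hypergraph with the single hyperedge \<open>e\<close>, which keeps its weight.\<close>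

definition dsingle :: "'v dhypergraph \<Rightarrow> 'v dhyperedge \<Rightarrow> 'v dhypergraph" where
  "dsingle H e = H\<lparr>dedges := {e}\<rparr>"

definition single :: "'v hypergraph \<Rightarrow> 'v set \<Rightarrow> 'v hypergraph" where
  "single G e = G\<lparr>edges := {e}\<rparr>"

text \<open>Tail and head may overlap; a common vertex is counted once.\<close>

definition dedge_size :: "'v dhyperedge \<Rightarrow> nat" where
  "dedge_size e = card (fst e \<union> snd e)"

definition max_dedge_size :: "'v dhypergraph \<Rightarrow> nat" where
  "max_dedge_size H = Max (dedge_size ` dedges H)"


section \<open>A real RAM\<close>

text \<open>
  Structured programs over integer (word) registers and real registers, with finitely many
  randomly accessible arrays of either kind. Every operation and every test costs one unit.
  Real arithmetic and comparisons are exact; reals cannot be converted to integers.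
\<close>

record state =
  ireg :: "string \<Rightarrow> nat"
  rreg :: "string \<Rightarrow> real"
  iarr :: "string \<Rightarrow> nat \<Rightarrow> nat"
  rarr :: "string \<Rightarrow> nat \<Rightarrow> real"

datatype iop = IAdd | ISub | IMul

datatype rop = RAdd | RSub | RMul | RDiv

fun iop_val :: "iop \<Rightarrow> nat \<Rightarrow> nat \<Rightarrow> nat" where
  "iop_val IAdd a b = a + b"
| "iop_val ISub a b = a - b"
| "iop_val IMul a b = a * b"

fun rop_val :: "rop \<Rightarrow> real \<Rightarrow> real \<Rightarrow> real" where
  "rop_val RAdd a b = a + b"
| "rop_val RSub a b = a - b"
| "rop_val RMul a b = a * b"
| "rop_val RDiv a b = a / b"

datatype test = ILess string string | RLess string string

fun test_val :: "test \<Rightarrow> state \<Rightarrow> bool" where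
  "test_val (ILess x y) s \<longleftrightarrow> ireg s x < ireg s y"
| "test_val (RLess x y) s \<longleftrightarrow> rreg s x < rreg s y"

text \<open>In array instructions the address is held by the integer register named last in a load
  and second in a store.\<close>

datatype com =
    Skip
  | IConst string nat
  | IArith string iop string string
  | ILoad string string string
  | IStore string string string
  | RConst string int
  | RArith string rop string string
  | RLoad string string string
  | RStore string string string
  | Seq com com
  | Cond test com com
  | While test com

text \<open>
  \<open>exec B c s t s'\<close>: from state \<open>s\<close> the program \<open>c\<close> halts in state \<open>s'\<close> after \<open>t\<close> steps, and
  all integers written to registers on the way are at most \<open>B\<close>. The bound stands for the word
  length: unit cost for integer operations is only justified if the integers have logarithmically
  many bits. A computation that exceeds it has no derivation.
\<close>

inductive exec :: "nat \<Rightarrow> com \<Rightarrow> state \<Rightarrow> nat \<Rightarrow> state \<Rightarrow> bool" for B where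
  Skip: "exec B Skip s 1 s"
| IConst: "k \<le> B \<Longrightarrow> exec B (IConst x k) s 1 (s\<lparr>ireg := (ireg s)(x := k)\<rparr>)"
| IArith: "k = iop_val f (ireg s y) (ireg s z) \<Longrightarrow> k \<le> B \<Longrightarrow>
    exec B (IArith x f y z) s 1 (s\<lparr>ireg := (ireg s)(x := k)\<rparr>)"
| ILoad: "k = iarr s a (ireg s y) \<Longrightarrow> k \<le> B \<Longrightarrow>
    exec B (ILoad x a y) s 1 (s\<lparr>ireg := (ireg s)(x := k)\<rparr>)"
| IStore: "exec B (IStore a y x) s 1
    (s\<lparr>iarr := (iarr s)(a := (iarr s a)(ireg s y := ireg s x))\<rparr>)"
| RConst: "exec B (RConst x q) s 1 (s\<lparr>rreg := (rreg s)(x := of_int q)\<rparr>)"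
| RArith: "exec B (RArith x f y z) s 1
    (s\<lparr>rreg := (rreg s)(x := rop_val f (rreg s y) (rreg s z))\<rparr>)"
| RLoad: "exec B (RLoad x a y) s 1 (s\<lparr>rreg := (rreg s)(x := rarr s a (ireg s y))\<rparr>)"
| RStore: "exec B (RStore a y x) s 1
    (s\<lparr>rarr := (rarr s)(a := (rarr s a)(ireg s y := rreg s x))\<rparr>)"
| Seq: "exec B c1 s1 t1 s2 \<Longrightarrow> exec B c2 s2 t2 s3 \<Longrightarrow> exec B (Seq c1 c2) s1 (t1 + t2) s3"
| CondTrue: "test_val b s \<Longrightarrow> exec B c1 s t s' \<Longrightarrow> exec B (Cond b c1 c2) s (t + 1) s'"
| CondFalse: "\<not> test_val b s \<Longrightarrow> exec B c2 s t s' \<Longrightarrow> exec B (Cond b c1 c2) s (t + 1) s'"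
| WhileFalse: "\<not> test_val b s \<Longrightarrow> exec B (While b c) s 1 s"
| WhileTrue: "test_val b s1 \<Longrightarrow> exec B c s1 t1 s2 \<Longrightarrow> exec B (While b c) s2 t2 s3 \<Longrightarrow>
    exec B (While b c) s1 (t1 + t2 + 1) s3"


section \<open>Representation of inputs and outputs\<close>

text \<open>Hypergraphs on the vertices \<open>0, \<dots>, n - 1\<close> are given by their number of vertices and a
  list of their hyperedges and weights, in any order and without repetitions.\<close>

definition lists_dhypergraph ::
  "nat \<Rightarrow> (nat list \<times> nat list \<times> real) list \<Rightarrow> nat dhypergraph \<Rightarrow> bool" where
  "lists_dhypergraph n D H \<longleftrightarrow> dverts H = {..<n} \<and>
     (let es = map (\<lambda>(l, r, w). (set l, set r)) D in distinct es \<and> set es = dedges H) \<and>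
     (\<forall>(l, r, w)\<in>set D. distinct l \<and> distinct r \<and> w = dweight H (set l, set r))"

definition lists_hypergraph ::
  "nat \<Rightarrow> (nat list \<times> real) list \<Rightarrow> nat hypergraph \<Rightarrow> bool" where
  "lists_hypergraph n D G \<longleftrightarrow> verts G = {..<n} \<and>
     (let es = map (\<lambda>(l, w). set l) D in distinct es \<and> set es = edges G) \<and>
     (\<forall>(l, w)\<in>set D. distinct l \<and> w = weight G (set l))"

definition holds_list :: "(nat \<Rightarrow> 'a) \<Rightarrow> 'a list \<Rightarrow> bool" where
  "holds_list a xs \<longleftrightarrow> (\<forall>i<length xs. a i = xs ! i)"

text \<open>Vertex lists are laid out one after the other, each preceded by its length. Registers and
  array cells not mentioned may have arbitrary contents.\<close>

definition input_dhypergraph :: "nat dhypergraph \<Rightarrow> state \<Rightarrow> bool" where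
  "input_dhypergraph H s \<longleftrightarrow> (\<exists>n D. lists_dhypergraph n D H \<and>
     ireg s ''n'' = n \<and> ireg s ''m'' = length D \<and>
     holds_list (iarr s ''edges'')
       (concat (map (\<lambda>(l, r, w). (length l # l) @ (length r # r)) D)) \<and>
     holds_list (rarr s ''weights'') (map (\<lambda>(l, r, w). w) D))"

definition output_hypergraph :: "nat hypergraph \<Rightarrow> state \<Rightarrow> bool" where
  "output_hypergraph G s \<longleftrightarrow> (\<exists>n D. lists_hypergraph n D G \<and>
     ireg s ''out_n'' = n \<and> ireg s ''out_m'' = length D \<and>
     holds_list (iarr s ''out_edges'') (concat (map (\<lambda>(l, w). length l # l) D)) \<and>
     holds_list (rarr s ''out_weights'') (map (\<lambda>(l, w). w) D))"

definition input_vector :: "nat \<Rightarrow> (nat \<Rightarrow> real) \<Rightarrow> state \<Rightarrow> bool" where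
  "input_vector n x s \<longleftrightarrow> ireg s ''n'' = n \<and> (\<forall>i<n. rarr s ''x'' i = x i)"

definition output_vector :: "nat \<Rightarrow> (nat \<Rightarrow> real) \<Rightarrow> state \<Rightarrow> bool" where
  "output_vector N y s \<longleftrightarrow> (\<forall>i<N. rarr s ''out'' i = y i)"

text \<open>
  \<open>\<psi>\<close> is computable in time \<open>O(m r\<^sup>2)\<close> and \<open>\<theta>\<close> in time \<open>O(n\<^sup>2)\<close>, by one program each, on words of
  length logarithmic in \<open>n + m\<close> and in \<open>n\<close>, respectively. The \<open>max 1\<close> only matters for a
  hypergraph without hyperedges and for \<open>n = 0\<close>, where some constant time is needed.
\<close>

definition hypergraph_map_computable :: "(nat dhypergraph \<Rightarrow> nat hypergraph) \<Rightarrow> bool" where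
  "hypergraph_map_computable \<psi> \<longleftrightarrow> (\<exists>P C k. \<forall>H s.
     directed_hypergraph H \<and> input_dhypergraph H s \<longrightarrow>
     (let n = card (dverts H); m = card (dedges H); r = max_dedge_size H in
       \<exists>t s'. exec ((n + m + 2) ^ k) P s t s' \<and> t \<le> C * max 1 (m * r\<^sup>2) \<and>
              output_hypergraph (\<psi> H) s'))"

definition vector_map_computable :: "(nat \<Rightarrow> (nat \<Rightarrow> real) \<Rightarrow> nat \<Rightarrow> real) \<Rightarrow> bool" where
  "vector_map_computable \<theta> \<longleftrightarrow> (\<exists>P C k. \<forall>n x s. input_vector n x s \<longrightarrow>
     (\<exists>t s'. exec ((n + 2) ^ k) P s t s' \<and> t \<le> C * max 1 (n\<^sup>2) \<and>
             output_vector (n\<^sup>2 + 1) (\<theta> n x) s'))"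

end

theory Submission
  imports Defs
begin

text \<open>
  The vertices of \<open>\<psi>(H)\<close> are the ordered pairs of vertices of \<open>H\<close>, with \<open>(u, v)\<close> encoded
  as \<open>u n + v\<close>, and one extra vertex \<open>n\<^sup>2\<close>. The vector \<open>\<theta>(x)\<close> has the value
  \<open>(x\<^sub>u - x\<^sub>v)\<^sub>+\<close> at \<open>(u, v)\<close> and \<open>0\<close> at the extra vertex. As \<open>\<theta>(x)\<close> is nonnegative, the largest
  squared difference on a vertex set on which it vanishes somewhere is its largest squared value.
  So a hyperedge \<open>(L, R)\<close> can be sent to \<open>L \<times> R\<close>, augmented by the extra vertex if \<open>L\<close> and
  \<open>R\<close> are disjoint; otherwise a pair \<open>(u, u)\<close> already has the value \<open>0\<close>, and adding a vertex
  would break the size bound when \<open>L = R\<close>.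
\<close>

section \<open>The reduction\<close>

definition pair_edge :: "nat \<Rightarrow> nat dhyperedge \<Rightarrow> nat set" where
  "pair_edge n e = (\<lambda>(u, v). u * n + v) ` (fst e \<times> snd e) \<union>
     (if fst e \<inter> snd e = {} then {n\<^sup>2} else {})"

text \<open>The value 0 from \<open>n\<^sup>2\<close> on covers the extra vertex and keeps the
  function nonnegative at every index.\<close>

definition pair_vector :: "nat \<Rightarrow> (nat \<Rightarrow> real) \<Rightarrow> nat \<Rightarrow> real" where
  "pair_vector n x i = (if i < n\<^sup>2 then max (x (i div n) - x (i mod n)) 0 else 0)"

text \<open>An image hyperedge inherits the weight of its preimage. The inverse is meaningful
  because \<open>pair_edge n\<close> is injective on the hyperedges
  (\<open>inj_on_pair_edge_dedges\<close>).\<close>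

definition pair_hypergraph :: "nat dhypergraph \<Rightarrow> nat hypergraph" where
  "pair_hypergraph H = (let n = card (dverts H) in
     \<lparr>verts = {..<n\<^sup>2 + 1}, edges = pair_edge n ` dedges H,
      weight = (\<lambda>f. dweight H (inv_into (dedges H) (pair_edge n) f))\<rparr>)"

lemma pair_index_less:
  fixes u v n :: nat
  assumes "u < n" "v < n"
  shows "u * n + v < n\<^sup>2"
proof -
  have "u * n + v < Suc u * n" using assms by simp
  also have "\<dots> \<le> n * n" using assms by (intro mult_right_mono) auto
  finally show ?thesis by (simp add: power2_eq_square)
qed

lemma pair_index_eq_iff:
  fixes u v u' v' n :: nat
  assumes "v < n" "v' < n"
  shows "u * n + v = u' * n + v' \<longleftrightarrow> u = u' \<and> v = v'"
proof
  assume eq: "u * n + v = u' * n + v'"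
  have "(u * n + v) div n = (u' * n + v') div n" "(u * n + v) mod n = (u' * n + v') mod n"
    using eq by simp_all
  then show "u = u' \<and> v = v'" using assms by simp
qed simp

lemma pair_vector_pair:
  "u < n \<Longrightarrow> v < n \<Longrightarrow> pair_vector n x (u * n + v) = max (x u - x v) 0"
  by (simp add: pair_vector_def pair_index_less)

lemma pair_vector_top [simp]: "pair_vector n x (n\<^sup>2) = 0"
  by (simp add: pair_vector_def)

lemma pair_vector_nonneg: "0 \<le> pair_vector n x i"
  by (simp add: pair_vector_def)

lemma pair_vector_binary:
  assumes "\<forall>i<n. x i \<in> {0, 1}"
  shows "pair_vector n x i \<in> {0, 1}"
proof (cases "i < n\<^sup>2")
  case True
  then have "n > 0" by (cases n) auto
  moreover have "i div n < n"
    using True \<open>n > 0\<close> by (simp add: power2_eq_square less_mult_imp_div_less)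
  ultimately have "x (i div n) \<in> {0, 1}" "x (i mod n) \<in> {0, 1}" using assms by auto
  then show ?thesis using True by (auto simp: pair_vector_def)
qed (simp add: pair_vector_def)

section \<open>The image of a single hyperedge: size, quadratic form, injectivity\<close>

text \<open>For disjoint \<open>L\<close> and \<open>R\<close> the square of |L| + |R| contains both
  |L| |R| and |L| |L| \<ge> 1, and the latter pays for the extra vertex. Otherwise there is no extra
  vertex, and each factor of |L| |R| is at most the size of the union.\<close>

lemma card_pair_edge:
  assumes "finite (fst e)" "finite (snd e)" "fst e \<noteq> {}" "snd e \<noteq> {}"
  shows "card (pair_edge n e) \<le> (dedge_size e)\<^sup>2"
proof -
  let ?L = "fst e" and ?R = "snd e"
  have im: "card ((\<lambda>(u, v). u * n + v) ` (?L \<times> ?R)) \<le> card ?L * card ?R"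
    using card_image_le[of "?L \<times> ?R"] assms by (simp add: card_cartesian_product)
  show ?thesis
  proof (cases "?L \<inter> ?R = {}")
    case True
    have "card (pair_edge n e) \<le> card ?L * card ?R + 1"
      using im True card_Un_le[of "(\<lambda>(u, v). u * n + v) ` (?L \<times> ?R)" "{n\<^sup>2}"]
      by (simp add: pair_edge_def)
    also have "\<dots> \<le> (card ?L + card ?R)\<^sup>2"
    proof -
      have "0 < card ?L" "0 < card ?R" using assms by (simp_all add: card_gt_0_iff)
      then have "1 \<le> card ?L * card ?L" by simp
      then show ?thesis unfolding power2_eq_square distrib_left distrib_right by linarith
    qed
    finally show ?thesis using True assms by (simp add: dedge_size_def card_Un_disjoint)
  next
    case False
    have "card (pair_edge n e) \<le> card ?L * card ?R" using im False by (simp add: pair_edge_def)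
    also have "\<dots> \<le> card (?L \<union> ?R) * card (?L \<union> ?R)"
      using assms by (intro mult_mono card_mono) auto
    finally show ?thesis by (simp add: dedge_size_def power2_eq_square)
  qed
qed

text \<open>Some \<open>z\<close> in the edge has \<open>y z = 0\<close>. Every squared value is
  thus a squared difference from \<open>y z\<close>; conversely, the difference of two nonnegative
  values never exceeds the larger one.\<close>

lemma Max_pair_edge:
  fixes x :: "nat \<Rightarrow> real"
  assumes "L \<subseteq> {..<n}" "R \<subseteq> {..<n}" "L \<noteq> {}" "R \<noteq> {}"
  defines "y \<equiv> pair_vector n x"
  shows "Max {(y a - y b)\<^sup>2 | a b. a \<in> pair_edge n (L, R) \<and> b \<in> pair_edge n (L, R)}
       = Max {(max (x u - x v) 0)\<^sup>2 | u v. u \<in> L \<and> v \<in> R}" (is "Max ?A = Max ?B")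
proof -
  let ?e = "pair_edge n (L, R)"
  have fin: "finite L" "finite R" using assms finite_subset by blast+
  have finB: "finite ?B"
  proof -
    have "?B = (\<lambda>(u, v). (max (x u - x v) 0)\<^sup>2) ` (L \<times> R)" by auto
    then show ?thesis using fin by simp
  qed
  have finA: "finite ?A"
  proof -
    have "?A = (\<lambda>(a, b). (y a - y b)\<^sup>2) ` (?e \<times> ?e)" by auto
    moreover have "finite ?e" using fin by (simp add: pair_edge_def)
    ultimately show ?thesis by simp
  qed
  have y_pair: "y (u * n + v) = max (x u - x v) 0" if "u \<in> L" "v \<in> R" for u v
    using that assms(1,2) unfolding y_def by (intro pair_vector_pair) auto
  have y_nonneg: "0 \<le> y a" for a
    unfolding y_def by (rule pair_vector_nonneg)
  \<comment> \<open>The zero is the extra vertex if \<open>L\<close> and \<open>R\<close> are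
    disjoint, and a diagonal pair \<open>(u, u)\<close> otherwise.\<close>
  obtain z where z: "z \<in> ?e" "y z = 0"
  proof (cases "L \<inter> R = {}")
    case True
    then show ?thesis using that[of "n\<^sup>2"] by (simp add: pair_edge_def y_def)
  next
    case False
    then obtain u where "u \<in> L" "u \<in> R" by blast
    moreover from this have "u * n + u \<in> ?e" by (force simp: pair_edge_def)
    ultimately show ?thesis using that[of "u * n + u"] y_pair by simp
  qed
  have B_le: "(y a)\<^sup>2 \<le> Max ?B" if "a \<in> ?e" for a
  proof (cases "\<exists>u\<in>L. \<exists>v\<in>R. a = u * n + v")
    case True
    then obtain u v where "u \<in> L" "v \<in> R" "a = u * n + v" by blast
    then show ?thesis using y_pair by (auto intro!: Max_ge finB)
  next
    case False
    then have "a = n\<^sup>2" using that by (auto simp: pair_edge_def split: if_splits)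
    moreover obtain u v where "u \<in> L" "v \<in> R" using assms by blast
    moreover from this have "(max (x u - x v) 0)\<^sup>2 \<le> Max ?B" by (intro Max_ge finB) auto
    \<comment> \<open>The extra vertex contributes 0, which is below the maximum because the maximum
      dominates some square.\<close>
    ultimately show ?thesis using order_trans[OF zero_le_power2] by (simp add: y_def)
  qed
  show ?thesis
  proof (rule antisym)
    show "Max ?A \<le> Max ?B"
    proof (rule Max.boundedI[OF finA])
      show "?A \<noteq> {}" using z by blast
      fix c assume "c \<in> ?A"
      then obtain a b where ab: "a \<in> ?e" "b \<in> ?e" "c = (y a - y b)\<^sup>2" by blast
      have "\<bar>y a - y b\<bar> \<le> max (y a) (y b)" using y_nonneg[of a] y_nonneg[of b] by linarith
      then have "c \<le> (max (y a) (y b))\<^sup>2" unfolding ab(3) by (simp add: abs_le_square_iff [symmetric])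
      also have "\<dots> \<le> Max ?B" using B_le ab by (simp add: max_def)
      finally show "c \<le> Max ?B" .
    qed
    show "Max ?B \<le> Max ?A"
    proof (rule Max.boundedI[OF finB])
      show "?B \<noteq> {}" using assms by blast
      fix c assume "c \<in> ?B"
      then obtain u v where uv: "u \<in> L" "v \<in> R" "c = (max (x u - x v) 0)\<^sup>2" by blast
      then have "c = (y (u * n + v) - y z)\<^sup>2" "u * n + v \<in> ?e"
        using y_pair z by (auto simp: pair_edge_def)
      then show "c \<le> Max ?A" using z by (intro Max_ge finA) blast
    qed
  qed
qed

text \<open>An explicit left inverse: intersecting with \<open>{..<n\<^sup>2}\<close> removes the
  extra vertex, then \<open>div n\<close> and \<open>mod n\<close> project the codes of
  \<open>L \<times> R\<close> to \<open>L\<close> and to \<open>R\<close>. Nonemptiness makes both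
  projections onto.\<close>

lemma inj_on_pair_edge:
  "inj_on (pair_edge n) {(L, R). L \<subseteq> {..<n} \<and> R \<subseteq> {..<n} \<and> L \<noteq> {} \<and> R \<noteq> {}}"
proof (rule inj_on_inverseI)
  fix e :: "nat dhyperedge"
  assume "e \<in> {(L, R). L \<subseteq> {..<n} \<and> R \<subseteq> {..<n} \<and> L \<noteq> {} \<and> R \<noteq> {}}"
  then obtain L R where e: "e = (L, R)" "L \<subseteq> {..<n}" "R \<subseteq> {..<n}" "L \<noteq> {}" "R \<noteq> {}"
    by auto
  have "u * n + v < n\<^sup>2" if "u \<in> L" "v \<in> R" for u v
    using e that by (intro pair_index_less) auto
  then have "pair_edge n e \<inter> {..<n\<^sup>2} = (\<lambda>(u, v). u * n + v) ` (L \<times> R)"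
    using e by (auto simp: pair_edge_def)
  moreover have "(\<lambda>i. i div n) ` (\<lambda>(u, v). u * n + v) ` (L \<times> R) = (\<lambda>(u, v). u) ` (L \<times> R)"
    "(\<lambda>i. i mod n) ` (\<lambda>(u, v). u * n + v) ` (L \<times> R) = (\<lambda>(u, v). v) ` (L \<times> R)"
    unfolding image_image using e by (auto intro!: image_cong)
  ultimately show "(\<lambda>E. ((\<lambda>i. i div n) ` (E \<inter> {..<n\<^sup>2}), (\<lambda>i. i mod n) ` (E \<inter> {..<n\<^sup>2})))
      (pair_edge n e) = e"
    using e by (force simp: image_iff)
qed

section \<open>From hyperedges to the whole hypergraph\<close>

lemma directed_hypergraph_edge:
  assumes "directed_hypergraph H" "e \<in> dedges H"
  shows "fst e \<subseteq> dverts H" "snd e \<subseteq> dverts H" "fst e \<noteq> {}" "snd e \<noteq> {}"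
    "finite (fst e)" "finite (snd e)"
proof -
  have fin: "finite (dverts H)" using assms by (simp add: directed_hypergraph_def)
  show sub: "fst e \<subseteq> dverts H" "snd e \<subseteq> dverts H" and "fst e \<noteq> {}" "snd e \<noteq> {}"
    using assms by (auto simp: directed_hypergraph_def case_prod_beta dest!: bspec[of _ _ e])
  show "finite (fst e)" "finite (snd e)" using sub fin by (blast intro: finite_subset)+
qed

lemma inj_on_pair_edge_dedges:
  assumes "directed_hypergraph H" "dverts H = {..<n}"
  shows "inj_on (pair_edge n) (dedges H)"
proof (rule inj_on_subset[OF inj_on_pair_edge], rule subsetI)
  fix e assume "e \<in> dedges H"
  then show "e \<in> {(L, R). L \<subseteq> {..<n} \<and> R \<subseteq> {..<n} \<and> L \<noteq> {} \<and> R \<noteq> {}}"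
    using directed_hypergraph_edge[OF assms(1), of e] assms(2) by (simp add: case_prod_beta)
qed

lemma pair_edge_subset:
  assumes "directed_hypergraph H" "dverts H = {..<n}" "e \<in> dedges H"
  shows "pair_edge n e \<subseteq> {..<n\<^sup>2 + 1}" "pair_edge n e \<noteq> {}"
proof -
  have "u * n + v < n\<^sup>2" if "u \<in> fst e" "v \<in> snd e" for u v
    using directed_hypergraph_edge[OF assms(1,3)] assms(2) that by (intro pair_index_less) auto
  then show "pair_edge n e \<subseteq> {..<n\<^sup>2 + 1}" by (auto simp: pair_edge_def less_Suc_eq)
  show "pair_edge n e \<noteq> {}"
    using directed_hypergraph_edge[OF assms(1,3)] by (auto simp: pair_edge_def)
qed

lemma pair_hypergraph_simps:
  assumes "directed_hypergraph H" "dverts H = {..<n}"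
  shows "verts (pair_hypergraph H) = {..<n\<^sup>2 + 1}"
    "edges (pair_hypergraph H) = pair_edge n ` dedges H"
    "e \<in> dedges H \<Longrightarrow> weight (pair_hypergraph H) (pair_edge n e) = dweight H e"
  using inj_on_pair_edge_dedges[OF assms] assms(2)
  by (simp_all add: pair_hypergraph_def Let_def)

lemma undirected_pair_hypergraph:
  assumes "directed_hypergraph H" "dverts H = {..<n}"
  shows "undirected_hypergraph (pair_hypergraph H)"
  unfolding undirected_hypergraph_def pair_hypergraph_simps(1,2)[OF assms] ball_simps
proof (intro conjI ballI finite_lessThan)
  fix e assume e: "e \<in> dedges H"
  show "pair_edge n e \<subseteq> {..<n\<^sup>2 + 1}" "pair_edge n e \<noteq> {}"
    using pair_edge_subset[OF assms e] by auto
  show "0 \<le> weight (pair_hypergraph H) (pair_edge n e)"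
    using assms(1) e by (simp add: pair_hypergraph_simps(3)[OF assms e] directed_hypergraph_def)
qed

text \<open>Injectivity reindexes the sum, and \<open>Max_pair_edge\<close> matches it term by term.
  The set \<open>F\<close> is arbitrary so that \<open>dedges H\<close> gives the identity for the
  hypergraph and \<open>{e}\<close> the one for a single hyperedge.\<close>

lemma laplacian_form_pair_edges:
  assumes H: "directed_hypergraph H" "dverts H = {..<n}" and F: "F \<subseteq> dedges H"
  shows "laplacian_form (pair_hypergraph H\<lparr>edges := pair_edge n ` F\<rparr>) (pair_vector n x)
    = dlaplacian_form (H\<lparr>dedges := F\<rparr>) x"
proof -
  have inj: "inj_on (pair_edge n) F"
    using inj_on_pair_edge_dedges[OF H] F by (rule inj_on_subset)
  have "weight (pair_hypergraph H) (pair_edge n e) *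
      Max {(pair_vector n x u - pair_vector n x v)\<^sup>2 | u v. u \<in> pair_edge n e \<and> v \<in> pair_edge n e}
    = (case e of (L, R) \<Rightarrow> dweight H (L, R) * Max {(max (x u - x v) 0)\<^sup>2 | u v. u \<in> L \<and> v \<in> R})"
    if "e \<in> F" for e
  proof -
    have "e \<in> dedges H" using F that by blast
    moreover obtain L R where "e = (L, R)" by fastforce
    ultimately show ?thesis
      using directed_hypergraph_edge[OF H(1), of e] H(2)
      by (simp add: pair_hypergraph_simps(3)[OF H] Max_pair_edge)
  qed
  then show ?thesis
    by (simp add: laplacian_form_def dlaplacian_form_def sum.reindex[OF inj])
qed

section \<open>Reasoning about programs\<close>

text \<open>\<open>t\<close> is the time elapsed before \<open>c\<close> starts; the postcondition receives the time
  at which it halts.\<close>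

definition wp :: "nat \<Rightarrow> com \<Rightarrow> (state \<Rightarrow> nat \<Rightarrow> bool) \<Rightarrow> state \<Rightarrow> nat \<Rightarrow> bool" where
  "wp B c Q s t \<longleftrightarrow> (\<exists>u s'. exec B c s u s' \<and> Q s' (t + u))"

\<comment> \<open>\<open>While\<close> is left out, since its equation would unfold forever; loops
  go through an invariant.\<close>
inductive_simps exec_simps:
  "exec B Skip s t s'"
  "exec B (IConst x k) s t s'"
  "exec B (IArith x f y z) s t s'"
  "exec B (ILoad x a y) s t s'"
  "exec B (IStore a y x) s t s'"
  "exec B (RConst x q) s t s'"
  "exec B (RArith x g y z) s t s'"
  "exec B (RLoad x a y) s t s'"
  "exec B (RStore a y x) s t s'"
  "exec B (Seq c1 c2) s t s'"
  "exec B (Cond b c1 c2) s t s'"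

text \<open>Used as symbolic execution: straight-line code reduces to word bounds and the
  postcondition at the final state.\<close>

lemma wp_simps [simp]:
  "wp B Skip Q s t \<longleftrightarrow> Q s (Suc t)"
  "wp B (IConst x k) Q s t \<longleftrightarrow> k \<le> B \<and> Q (s\<lparr>ireg := (ireg s)(x := k)\<rparr>) (Suc t)"
  "wp B (IArith x f y z) Q s t \<longleftrightarrow> iop_val f (ireg s y) (ireg s z) \<le> B \<and>
     Q (s\<lparr>ireg := (ireg s)(x := iop_val f (ireg s y) (ireg s z))\<rparr>) (Suc t)"
  "wp B (ILoad x a y) Q s t \<longleftrightarrow> iarr s a (ireg s y) \<le> B \<and>
     Q (s\<lparr>ireg := (ireg s)(x := iarr s a (ireg s y))\<rparr>) (Suc t)"
  "wp B (IStore a y x) Q s t \<longleftrightarrow>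
     Q (s\<lparr>iarr := (iarr s)(a := (iarr s a)(ireg s y := ireg s x))\<rparr>) (Suc t)"
  "wp B (RConst x q) Q s t \<longleftrightarrow> Q (s\<lparr>rreg := (rreg s)(x := of_int q)\<rparr>) (Suc t)"
  "wp B (RArith x g y z) Q s t \<longleftrightarrow>
     Q (s\<lparr>rreg := (rreg s)(x := rop_val g (rreg s y) (rreg s z))\<rparr>) (Suc t)"
  "wp B (RLoad x a y) Q s t \<longleftrightarrow>
     Q (s\<lparr>rreg := (rreg s)(x := rarr s a (ireg s y))\<rparr>) (Suc t)"
  "wp B (RStore a y x) Q s t \<longleftrightarrow>
     Q (s\<lparr>rarr := (rarr s)(a := (rarr s a)(ireg s y := rreg s x))\<rparr>) (Suc t)"
  "wp B (Seq c1 c2) Q s t \<longleftrightarrow> wp B c1 (wp B c2 Q) s t"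
  by (auto simp: wp_def exec_simps) (metis add.assoc)+

lemma wp_Cond [simp]:
  "wp B (Cond b c1 c2) Q s t \<longleftrightarrow>
     (if test_val b s then wp B c1 Q s (Suc t) else wp B c2 Q s (Suc t))"
  by (auto simp: wp_def exec_simps) (metis add_Suc_right)+

lemma wp_mono:
  assumes "wp B c P s t" "\<And>s' t'. P s' t' \<Longrightarrow> Q s' t'"
  shows "wp B c Q s t"
  using assms unfolding wp_def by blast

text \<open>The number \<open>k\<close> of iterations is known in advance, so the invariant is
  indexed by the iterations done and the induction runs on those remaining. Each
  \<open>Suc t\<close> charges one evaluation of the test.\<close>

lemma wp_While_upto:
  assumes init: "I 0 s t"
    and step: "\<And>i s t. i < k \<Longrightarrow> I i s t \<Longrightarrow> test_val b s \<and> wp B c (I (Suc i)) s (Suc t)"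
    and exit: "\<And>s t. I k s t \<Longrightarrow> \<not> test_val b s \<and> Q s (Suc t)"
  shows "wp B (While b c) Q s t"
proof -
  have "wp B (While b c) Q s t" if "I i s t" "i \<le> k" for i s t
    using that
  proof (induction "k - i" arbitrary: i s t)
    case 0
    then show ?case using exit[of s t] WhileFalse[of b s B c] unfolding wp_def by force
  next
    case (Suc d)
    then have "i < k" by simp
    then obtain u s' where u: "test_val b s" "exec B c s u s'" "I (Suc i) s' (Suc t + u)"
      using step Suc.prems(1) unfolding wp_def by blast
    from u(3) obtain u' s'' where u': "exec B (While b c) s' u' s''" "Q s'' (Suc t + u + u')"
      using Suc.hyps(1)[of "Suc i"] Suc.hyps(2) \<open>i < k\<close> unfolding wp_def
      by (metis Suc_leI diff_Suc_Suc add_Suc_right Suc_diff_Suc nat.inject)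
    have "exec B (While b c) s (u + u' + 1) s''"
      using u(1,2) u'(1) by (rule WhileTrue)
    then show ?case
      using u'(2) unfolding wp_def by (intro exI[of _ "u + u' + 1"] exI[of _ s'']) (simp add: ac_simps)
  qed
  then show ?thesis using init by blast
qed

notation Seq (infixr ";;" 60)

section \<open>Computing the vector\<close>

text \<open>Pairs are visited in the order of their codes, so the counter \<open>q\<close> replaces
  the computation of \<open>u * n + v\<close>.\<close>

definition vector_row :: com where
  "vector_row = While (ILess ''v'' ''n'') (
     RLoad ''xv'' ''x'' ''v'' ;;
     RArith ''y'' RSub ''xu'' ''xv'' ;;
     Cond (RLess ''y'' ''zero'') (RConst ''y'' 0) Skip ;;
     RStore ''out'' ''q'' ''y'' ;;
     IArith ''q'' IAdd ''q'' ''one'' ;;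
     IArith ''v'' IAdd ''v'' ''one'')"

definition vector_rows :: com where
  "vector_rows = While (ILess ''u'' ''n'') (
     RLoad ''xu'' ''x'' ''u'' ;;
     IConst ''v'' 0 ;;
     vector_row ;;
     IArith ''u'' IAdd ''u'' ''one'')"

text \<open>After all rows \<open>q\<close> is \<open>n * n\<close>, the index of the extra vertex,
  which the last store sets to 0.\<close>

definition vector_program :: com where
  "vector_program =
     IConst ''one'' 1 ;; RConst ''zero'' 0 ;; IConst ''u'' 0 ;; IConst ''q'' 0 ;;
     vector_rows ;;
     RStore ''out'' ''q'' ''zero''"

text \<open>The number \<open>q\<close> of cells already written is a separate argument because it
  advances within a row while \<open>u\<close> stays fixed.\<close>

definition vector_inv :: "nat \<Rightarrow> (nat \<Rightarrow> real) \<Rightarrow> nat \<Rightarrow> nat \<Rightarrow> state \<Rightarrow> bool" where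
  "vector_inv n x u q s \<longleftrightarrow> input_vector n x s \<and> ireg s ''one'' = 1 \<and> rreg s ''zero'' = 0 \<and>
     ireg s ''u'' = u \<and> ireg s ''q'' = q \<and> output_vector q (pair_vector n x) s"

text \<open>An iteration, including its test, takes 8 steps and is charged 9; the final 1 is the
  failing test.\<close>

lemma wp_vector_row:
  assumes inv: "vector_inv n x u (u * n) s" "ireg s ''v'' = 0" "rreg s ''xu'' = x u"
    and u: "u < n" and B: "n\<^sup>2 \<le> B"
  shows "wp B vector_row (\<lambda>s t'. vector_inv n x u (Suc u * n) s \<and> t' \<le> t + 9 * n + 1) s t"
  unfolding vector_row_def
proof (rule wp_While_upto[where k = n and I = "\<lambda>v s t'. vector_inv n x u (u * n + v) s \<and>
    ireg s ''v'' = v \<and> rreg s ''xu'' = x u \<and> t' \<le> t + 9 * v"], goal_cases)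
  case (2 v s t')
  \<comment> \<open>These two facts give the word bounds: the incremented \<open>q\<close> is at
    most \<open>n\<^sup>2\<close>, the incremented \<open>v\<close> at most
    \<open>n\<close>.\<close>
  have "u * n + v < n\<^sup>2" using u 2 by (intro pair_index_less)
  moreover have "n \<le> n\<^sup>2" by (simp add: power2_eq_square)
  ultimately show ?case
    using 2 B u
    by (auto simp: vector_inv_def input_vector_def output_vector_def pair_vector_pair less_Suc_eq)
qed (use inv in \<open>auto simp: vector_inv_def input_vector_def algebra_simps\<close>)

lemma wp_vector_rows:
  assumes inv: "vector_inv n x 0 0 s" and B: "n\<^sup>2 \<le> B"
  shows "wp B vector_rows (\<lambda>s t'. vector_inv n x n (n * n) s \<and> t' \<le> t + (9 * n + 5) * n + 1) s t"
  unfolding vector_rows_def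
proof (rule wp_While_upto[where k = n and
    I = "\<lambda>u s t'. vector_inv n x u (u * n) s \<and> t' \<le> t + (9 * n + 5) * u"], goal_cases)
  case (2 u s t')
  \<comment> \<open>The state when the inner loop starts, three steps later: the test, the load and
    the reset of \<open>v\<close>. With the increment of \<open>u\<close> and the exit from the
    inner loop, a row costs \<open>9 * n + 5\<close>.\<close>
  let ?s = "s\<lparr>rreg := (rreg s)(''xu'' := x u), ireg := (ireg s)(''v'' := 0)\<rparr>"
  have "n \<le> n\<^sup>2" by (simp add: power2_eq_square)
  have "wp B vector_row (\<lambda>s t''. vector_inv n x u (Suc u * n) s \<and> t'' \<le> t' + 3 + 9 * n + 1)
      ?s (t' + 3)"
    using 2 B by (intro wp_vector_row) (auto simp: vector_inv_def input_vector_def output_vector_def)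
  then have "wp B vector_row (wp B (IArith ''u'' IAdd ''u'' ''one'')
      (\<lambda>s t''. vector_inv n x (Suc u) (Suc u * n) s \<and> t'' \<le> t + (9 * n + 5) * Suc u)) ?s (t' + 3)"
    by (rule wp_mono)
      (use 2 B \<open>n \<le> n\<^sup>2\<close> in \<open>auto simp: vector_inv_def input_vector_def output_vector_def algebra_simps\<close>)
  moreover have "rarr s ''x'' u = x u" "ireg s ''u'' = u" "ireg s ''n'' = n"
    using 2 by (simp_all add: vector_inv_def input_vector_def)
  ultimately show ?case using 2 by (simp add: eval_nat_numeral)
qed (use inv in \<open>auto simp: vector_inv_def input_vector_def\<close>)

lemma wp_vector_program:
  assumes "input_vector n x s" and B: "n\<^sup>2 + 1 \<le> B"
  shows "wp B vector_program
    (\<lambda>s t. output_vector (n\<^sup>2 + 1) (pair_vector n x) s \<and> t \<le> 20 * max 1 (n\<^sup>2)) s 0"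
proof -
  \<comment> \<open>Four initial instructions, the loop with its exit test, and the final store. For
    \<open>n \<ge> 1\<close> the total \<open>9 * n\<^sup>2 + 5 * n + 6\<close> is at most
    \<open>(9 + 5 + 6) * n\<^sup>2\<close>, whence the constant 20.\<close>
  have time: "4 + (9 * n + 5) * n + 2 \<le> 20 * max 1 (n\<^sup>2)"
    by (cases n) (auto simp: power2_eq_square algebra_simps max_def)
  have final: "output_vector (n\<^sup>2 + 1) (pair_vector n x)
      (s\<lparr>rarr := (rarr s)(''out'' := (rarr s ''out'')(ireg s ''q'' := rreg s ''zero''))\<rparr>)"
    if "vector_inv n x n (n * n) s" for s
    using that by (auto simp: vector_inv_def output_vector_def less_Suc_eq simp flip: power2_eq_square)
  show ?thesis
    unfolding vector_program_def wp_simps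
  proof (intro conjI, goal_cases)
    case 4
    show ?case
    proof (rule wp_mono[OF wp_vector_rows[where n = n and x = x]], goal_cases)
      case (3 s' t')
      then show ?case using time final by simp
    qed (use assms in \<open>auto simp: vector_inv_def input_vector_def output_vector_def\<close>)
  qed (use B in auto)
qed

lemma vector_map_computable_pair_vector: "vector_map_computable pair_vector"
  unfolding vector_map_computable_def
proof (rule exI[of _ vector_program], rule exI[of _ 20], rule exI[of _ 2], intro allI impI)
  fix n x s assume "input_vector n x s"
  moreover have "n\<^sup>2 + 1 \<le> (n + 2) ^ 2" by (simp add: power2_eq_square algebra_simps)
  ultimately have "wp ((n + 2)\<^sup>2) vector_program
      (\<lambda>s t. output_vector (n\<^sup>2 + 1) (pair_vector n x) s \<and> t \<le> 20 * max 1 (n\<^sup>2)) s 0"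
    by (rule wp_vector_program)
  then show "\<exists>t s'. exec ((n + 2)\<^sup>2) vector_program s t s' \<and> t \<le> 20 * max 1 (n\<^sup>2) \<and>
      output_vector (n\<^sup>2 + 1) (pair_vector n x) s'"
    unfolding wp_def by auto
qed

section \<open>Computing the hypergraph\<close>

definition pair_indices :: "nat \<Rightarrow> nat list \<Rightarrow> nat list \<Rightarrow> nat list" where
  "pair_indices n l r = concat (map (\<lambda>u. map (\<lambda>v. u * n + v) r) l)"

text \<open>List form of \<open>pair_edge\<close> in the order in which the program writes it, with
  the extra vertex last.\<close>

definition edge_indices :: "nat \<Rightarrow> nat list \<Rightarrow> nat list \<Rightarrow> nat list" where
  "edge_indices n l r = pair_indices n l r @ (if set l \<inter> set r = {} then [n * n] else [])"

text \<open>The tail grows at its right end because the loop invariant speaks of prefixes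
  \<open>take j l\<close>.\<close>

lemma pair_indices_simps [simp]:
  "pair_indices n [] r = []"
  "pair_indices n (l @ [u]) r = pair_indices n l r @ map (\<lambda>v. u * n + v) r"
  by (simp_all add: pair_indices_def)

lemma length_pair_indices [simp]: "length (pair_indices n l r) = length l * length r"
  by (induction l) (simp_all add: pair_indices_def)

lemma set_edge_indices: "set (edge_indices n l r) = pair_edge n (set l, set r)"
  by (auto simp: edge_indices_def pair_indices_def pair_edge_def power2_eq_square)

lemma distinct_edge_indices:
  assumes "distinct l" "distinct r" "set l \<subseteq> {..<n}" "set r \<subseteq> {..<n}"
  shows "distinct (edge_indices n l r)"
proof -
  have "distinct (pair_indices n l r)"
    using assms(1,3)
  proof (induction l rule: rev_induct)
    case (snoc u l)
    have "u * n + v \<notin> set (pair_indices n l r)" if "v \<in> set r" for v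
    proof
      assume "u * n + v \<in> set (pair_indices n l r)"
      then obtain u' v' where "u' \<in> set l" "v' \<in> set r" "u * n + v = u' * n + v'"
        by (auto simp: pair_indices_def)
      then show False using snoc.prems assms(4) that by (auto simp: pair_index_eq_iff subset_iff)
    qed
    then show ?case using snoc assms(2) by (auto simp: distinct_map inj_on_def)
  qed simp
  moreover have "n * n \<notin> set (pair_indices n l r)"
  proof
    assume "n * n \<in> set (pair_indices n l r)"
    then obtain u v where "u \<in> set l" "v \<in> set r" "n * n = u * n + v"
      by (auto simp: pair_indices_def)
    then show False using assms pair_index_less[of u n v] by (auto simp: power2_eq_square subset_iff)
  qed
  ultimately show ?thesis by (simp add: edge_indices_def)
qed

section \<open>Writing lists into arrays\<close>

text \<open>The array \<open>a\<close> after \<open>xs\<close> has been written from cell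
  \<open>i\<close> on. Describing whole arrays lets successive writes be composed by
  equations.\<close>

definition put :: "(nat \<Rightarrow> 'a) \<Rightarrow> nat \<Rightarrow> 'a list \<Rightarrow> nat \<Rightarrow> 'a" where
  "put a i xs j = (if i \<le> j \<and> j < i + length xs then xs ! (j - i) else a j)"

lemma put_Nil [simp]: "put a i [] = a"
  by (rule ext) (auto simp: put_def)

lemma put_append: "put (put a i xs) (i + length xs) ys = put a i (xs @ ys)"
  by (rule ext) (auto simp: put_def nth_append)

lemma put_snoc: "(put a i xs)(i + length xs := y) = put a i (xs @ [y])"
  by (rule ext) (auto simp: put_def nth_append less_Suc_eq)

lemma put_Cons: "(put a (Suc i) xs)(i := x) = put a i (x # xs)"
  by (rule ext) (auto simp: put_def nth_Cons')

lemma holds_list_Cons: "holds_list a (x # xs) \<longleftrightarrow> a 0 = x \<and> holds_list (\<lambda>i. a (Suc i)) xs"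
  by (auto simp: holds_list_def nth_Cons split: nat.splits)

lemma holds_list_append:
  "holds_list a (xs @ ys) \<longleftrightarrow> holds_list a xs \<and> holds_list (\<lambda>i. a (length xs + i)) ys"
  unfolding holds_list_def
  by (auto simp: nth_append) (metis add_diff_inverse_nat nat_add_left_cancel_less)

lemma holds_list_put: "holds_list a xs \<Longrightarrow> holds_list (put a (length xs) ys) (xs @ ys)"
  unfolding holds_list_def put_def by (auto simp: nth_append)

section \<open>The program for the hypergraph\<close>

text \<open>Two strict comparisons detect \<open>u = v\<close>. The flag \<open>d\<close> starts at
  1 and drops to 0 at a common vertex of tail and head, so in the end it counts the extra vertices
  to add.\<close>

definition pair_row :: com where
  "pair_row = While (ILess ''k'' ''p'') (
     ILoad ''v'' ''edges'' ''k'' ;;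
     IArith ''c'' IAdd ''un'' ''v'' ;;
     IStore ''out_edges'' ''q'' ''c'' ;;
     IArith ''q'' IAdd ''q'' ''one'' ;;
     Cond (ILess ''u'' ''v'') Skip (Cond (ILess ''v'' ''u'') Skip (IConst ''d'' 0)) ;;
     IArith ''k'' IAdd ''k'' ''one'')"

text \<open>Cell \<open>lend\<close> holds the length of the head, hence the head itself starts at
  \<open>lend + 1\<close>.\<close>

definition pair_rows :: com where
  "pair_rows = While (ILess ''j'' ''lend'') (
     ILoad ''u'' ''edges'' ''j'' ;;
     IArith ''un'' IMul ''u'' ''n'' ;;
     IArith ''k'' IAdd ''lend'' ''one'' ;;
     pair_row ;;
     IArith ''j'' IAdd ''j'' ''one'')"

text \<open>\<open>j\<close> is set to the first vertex of the tail, \<open>lend\<close> to the cell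
  after the tail, and \<open>p\<close> to the cell after the head, where the next hyperedge
  begins.\<close>

definition edge_header :: com where
  "edge_header =
     ILoad ''a'' ''edges'' ''p'' ;;
     IArith ''j'' IAdd ''p'' ''one'' ;;
     IArith ''lend'' IAdd ''j'' ''a'' ;;
     ILoad ''b'' ''edges'' ''lend'' ;;
     IArith ''p'' IAdd ''lend'' ''b'' ;;
     IArith ''p'' IAdd ''p'' ''one'' ;;
     IArith ''q'' IAdd ''h'' ''one'' ;;
     IConst ''d'' 1"

text \<open>The length of a hyperedge is only known once its pairs are written, so it is stored afterwards
  into the cell \<open>h\<close> left free for it. The store of \<open>z\<close> is unconditional: if \<open>d = 0\<close>,
  the next hyperedge overwrites it.\<close>

definition edge_footer :: com where
  "edge_footer =
     IArith ''c'' IMul ''a'' ''b'' ;;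
     IArith ''c'' IAdd ''c'' ''d'' ;;
     IStore ''out_edges'' ''h'' ''c'' ;;
     IStore ''out_edges'' ''q'' ''z'' ;;
     IArith ''h'' IAdd ''q'' ''d'' ;;
     RLoad ''w'' ''weights'' ''i'' ;;
     RStore ''out_weights'' ''i'' ''w'' ;;
     IArith ''i'' IAdd ''i'' ''one''"

text \<open>There is no copy instruction, so \<open>m\<close> is copied by multiplying it by 1.
  Register \<open>z\<close> holds the extra vertex.\<close>

definition hypergraph_program :: com where
  "hypergraph_program =
     IConst ''one'' 1 ;; IArith ''z'' IMul ''n'' ''n'' ;; IArith ''out_n'' IAdd ''z'' ''one'' ;;
     IConst ''i'' 0 ;; IConst ''p'' 0 ;; IConst ''h'' 0 ;;
     While (ILess ''i'' ''m'') (edge_header ;; pair_rows ;; edge_footer) ;;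
     IArith ''out_m'' IMul ''m'' ''one''"

section \<open>Correctness and running time of the loops\<close>

text \<open>Frame condition for the pair loops: \<open>X\<close> collects the integer registers that
  they may overwrite.\<close>

definition agrees_outside :: "string set \<Rightarrow> state \<Rightarrow> state \<Rightarrow> bool" where
  "agrees_outside X s s' \<longleftrightarrow> (\<forall>x. x \<notin> X \<longrightarrow> ireg s' x = ireg s x) \<and>
     (\<forall>a. a \<noteq> ''out_edges'' \<longrightarrow> iarr s' a = iarr s a) \<and> rarr s' = rarr s"

text \<open>An iteration takes at most 9 steps: the loop test, up to 3 for the nested comparison,
  and five further instructions.\<close>

lemma wp_pair_row:
  assumes "ireg s ''p'' = ireg s ''k'' + length r" "ireg s ''one'' = 1"
    and r: "holds_list (\<lambda>i. iarr s ''edges'' (ireg s ''k'' + i)) r"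
    and B: "ireg s ''p'' \<le> B" "ireg s ''q'' + length r \<le> B" "\<forall>v\<in>set r. ireg s ''un'' + v \<le> B"
  shows "wp B pair_row (\<lambda>s' t'. agrees_outside {''v'', ''c'', ''q'', ''d'', ''k''} s s' \<and>
    ireg s' ''q'' = ireg s ''q'' + length r \<and>
    ireg s' ''d'' = (if ireg s ''u'' \<in> set r then 0 else ireg s ''d'') \<and>
    iarr s' ''out_edges'' = put (iarr s ''out_edges'') (ireg s ''q'') (map (\<lambda>v. ireg s ''un'' + v) r) \<and>
    t' \<le> t + 9 * length r + 1) s t"
  unfolding pair_row_def
proof (rule wp_While_upto[where k = "length r" and I = "\<lambda>j s' t'.
    agrees_outside {''v'', ''c'', ''q'', ''d'', ''k''} s s' \<and>
    ireg s' ''k'' = ireg s ''k'' + j \<and> ireg s' ''q'' = ireg s ''q'' + j \<and>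
    ireg s' ''d'' = (if ireg s ''u'' \<in> set (take j r) then 0 else ireg s ''d'') \<and>
    iarr s' ''out_edges'' =
      put (iarr s ''out_edges'') (ireg s ''q'') (map (\<lambda>v. ireg s ''un'' + v) (take j r)) \<and>
    t' \<le> t + 9 * j"], goal_cases)
  case (2 j s' t')
  have *: "ireg s' ''one'' = 1" "ireg s' ''p'' = ireg s ''k'' + length r"
    "ireg s' ''u'' = ireg s ''u''" "ireg s' ''un'' = ireg s ''un''"
    "iarr s' ''edges'' (ireg s ''k'' + j) = r ! j"
    using 2 assms by (simp_all add: agrees_outside_def holds_list_def)
  have "ireg s ''un'' + r ! j \<le> B" using B 2 by simp
  moreover from this have "r ! j \<le> B" by simp
  moreover have "put (iarr s ''out_edges'') (ireg s ''q'') (map (\<lambda>v. ireg s ''un'' + v) (take (Suc j) r)) =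
    (put (iarr s ''out_edges'') (ireg s ''q'') (map (\<lambda>v. ireg s ''un'' + v) (take j r)))
      (ireg s ''q'' + j := ireg s ''un'' + r ! j)"
    using 2 put_snoc[of "iarr s ''out_edges''" "ireg s ''q''" "map (\<lambda>v. ireg s ''un'' + v) (take j r)"]
    by (simp add: take_Suc_conv_app_nth)
  moreover have "set (take (Suc j) r) = insert (r ! j) (set (take j r))"
    using 2 by (simp add: take_Suc_conv_app_nth)
  ultimately show ?case
    using 2 B assms(1) * by (auto simp: agrees_outside_def)
qed (use assms in \<open>auto simp: agrees_outside_def\<close>)

lemma wp_pair_rows:
  assumes "ireg s ''lend'' = ireg s ''j'' + length l" "ireg s ''p'' = ireg s ''lend'' + 1 + length r"
    and "ireg s ''one'' = 1" "ireg s ''n'' = n"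
    and l: "holds_list (\<lambda>i. iarr s ''edges'' (ireg s ''j'' + i)) l"
    and r: "holds_list (\<lambda>i. iarr s ''edges'' (ireg s ''lend'' + 1 + i)) r"
    and lr: "set l \<subseteq> {..<n}" "set r \<subseteq> {..<n}"
    and B: "ireg s ''p'' \<le> B" "ireg s ''q'' + length l * length r \<le> B" "n * n \<le> B"
  shows "wp B pair_rows (\<lambda>s' t'.
    agrees_outside {''u'', ''un'', ''j'', ''v'', ''c'', ''q'', ''d'', ''k''} s s' \<and>
    ireg s' ''q'' = ireg s ''q'' + length l * length r \<and>
    ireg s' ''d'' = (if set l \<inter> set r = {} then ireg s ''d'' else 0) \<and>
    iarr s' ''out_edges'' = put (iarr s ''out_edges'') (ireg s ''q'') (pair_indices n l r) \<and>
    t' \<le> t + (9 * length r + 6) * length l + 1) s t"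
  unfolding pair_rows_def
proof (rule wp_While_upto[where k = "length l" and I = "\<lambda>j s' t'.
    agrees_outside {''u'', ''un'', ''j'', ''v'', ''c'', ''q'', ''d'', ''k''} s s' \<and>
    ireg s' ''j'' = ireg s ''j'' + j \<and> ireg s' ''q'' = ireg s ''q'' + j * length r \<and>
    ireg s' ''d'' = (if set (take j l) \<inter> set r = {} then ireg s ''d'' else 0) \<and>
    iarr s' ''out_edges'' = put (iarr s ''out_edges'') (ireg s ''q'') (pair_indices n (take j l) r) \<and>
    t' \<le> t + (9 * length r + 6) * j"], goal_cases)
  case (2 j s' t')
  let ?u = "l ! j"
  \<comment> \<open>The state in which the row starts, after the test and three instructions; hence
    the offset 4 below.\<close>
  let ?s = "s'\<lparr>ireg := (ireg s')(''u'' := ?u, ''un'' := ?u * n, ''k'' := ireg s ''lend'' + 1)\<rparr>"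
  have *: "ireg s' ''one'' = 1" "ireg s' ''p'' = ireg s ''lend'' + 1 + length r"
    "ireg s' ''lend'' = ireg s ''lend''" "ireg s' ''n'' = n"
    "iarr s' ''edges'' = iarr s ''edges''" "iarr s ''edges'' (ireg s ''j'' + j) = ?u"
    using 2 assms by (simp_all add: agrees_outside_def holds_list_def)
  have u: "?u < n" using 2 lr(1) nth_mem[of j l] by blast
  have un: "?u * n + v \<le> B" if "v \<in> set r" for v
    using pair_index_less[OF u, of v] lr that B by (auto simp: power2_eq_square)
  have uB: "?u * n \<le> B" "?u \<le> B" "?u * n + n \<le> n * n"
  proof -
    have "Suc ?u * n \<le> n * n" using u by (intro mult_right_mono) auto
    then show "?u * n + n \<le> n * n" by simp
    moreover have "?u \<le> ?u * n" using u by simp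
    ultimately show "?u * n \<le> B" "?u \<le> B" using B by linarith+
  qed
  \<comment> \<open>Keeps the write position \<open>q\<close> within the word bound until the end of
    row \<open>j\<close>.\<close>
  have jB: "Suc j * length r \<le> length l * length r" using 2 by (intro mult_right_mono) auto
  have "wp B pair_row (\<lambda>s'' t''. agrees_outside {''v'', ''c'', ''q'', ''d'', ''k''} ?s s'' \<and>
    ireg s'' ''q'' = ireg ?s ''q'' + length r \<and>
    ireg s'' ''d'' = (if ireg ?s ''u'' \<in> set r then 0 else ireg ?s ''d'') \<and>
    iarr s'' ''out_edges'' = put (iarr ?s ''out_edges'') (ireg ?s ''q'') (map (\<lambda>v. ireg ?s ''un'' + v) r) \<and>
    t'' \<le> t' + 4 + 9 * length r + 1) ?s (t' + 4)"
    by (rule wp_pair_row) (use 2 B * r un jB in \<open>auto simp: assms(2)\<close>)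
  then have "wp B pair_row (wp B (IArith ''j'' IAdd ''j'' ''one'') (\<lambda>s' t'.
    agrees_outside {''u'', ''un'', ''j'', ''v'', ''c'', ''q'', ''d'', ''k''} s s' \<and>
    ireg s' ''j'' = ireg s ''j'' + Suc j \<and> ireg s' ''q'' = ireg s ''q'' + Suc j * length r \<and>
    ireg s' ''d'' = (if set (take (Suc j) l) \<inter> set r = {} then ireg s ''d'' else 0) \<and>
    iarr s' ''out_edges'' = put (iarr s ''out_edges'') (ireg s ''q'') (pair_indices n (take (Suc j) l) r) \<and>
    t' \<le> t + (9 * length r + 6) * Suc j)) ?s (t' + 4)"
  proof (rule wp_mono, goal_cases)
    case (1 s'' t'')
    have "put (put (iarr s ''out_edges'') (ireg s ''q'') (pair_indices n (take j l) r))
        (ireg s ''q'' + j * length r) (map (\<lambda>v. ?u * n + v) r)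
      = put (iarr s ''out_edges'') (ireg s ''q'') (pair_indices n (take (Suc j) l) r)"
      using 2 put_append[of "iarr s ''out_edges''" "ireg s ''q''" "pair_indices n (take j l) r"]
      by (simp add: take_Suc_conv_app_nth)
    moreover have "set (take (Suc j) l) = insert ?u (set (take j l))"
      using 2 by (simp add: take_Suc_conv_app_nth)
    moreover have "ireg s ''j'' + Suc j \<le> B" using 2 assms(1,2) B by simp
    ultimately show ?case
      using 1 2 * by (auto simp: agrees_outside_def)
  qed
  then show ?case
    using 2 B * assms(1,2) uB by (simp add: eval_nat_numeral)
qed (use assms in \<open>auto simp: agrees_outside_def\<close>)

text \<open>The counter \<open>i\<close> and the free length cell \<open>h\<close> are determined by
  the lists already written; only the input position \<open>p\<close> is carried separately.\<close>

definition edges_inv ::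
  "nat \<Rightarrow> nat \<Rightarrow> (nat \<Rightarrow> nat) \<Rightarrow> (nat \<Rightarrow> real) \<Rightarrow> nat \<Rightarrow> nat list \<Rightarrow> real list \<Rightarrow> state \<Rightarrow> bool" where
  "edges_inv n m E W p out ws s \<longleftrightarrow>
     ireg s ''n'' = n \<and> ireg s ''m'' = m \<and> ireg s ''one'' = 1 \<and> ireg s ''z'' = n * n \<and>
     ireg s ''out_n'' = n * n + 1 \<and> ireg s ''i'' = length ws \<and> ireg s ''p'' = p \<and>
     ireg s ''h'' = length out \<and> iarr s ''edges'' = E \<and> rarr s ''weights'' = W \<and>
     holds_list (iarr s ''out_edges'') out \<and> holds_list (rarr s ''out_weights'') ws"

text \<open>The 17 extra steps are 8 for the header, 8 for the footer and 1 for the exit test of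
  \<open>pair_rows\<close>.\<close>

lemma wp_edge:
  defines "X n l r \<equiv> length (edge_indices n l r) # edge_indices n l r"
  assumes inv: "edges_inv n m E W p out ws s"
    and lr: "holds_list (\<lambda>i. E (p + i)) (length l # l @ length r # r)"
      "set l \<subseteq> {..<n}" "set r \<subseteq> {..<n}"
    and B: "p + length l + length r + 2 \<le> B" "length out + length l * length r + 2 \<le> B"
      "n * n \<le> B" "length ws < B"
  shows "wp B (edge_header ;; pair_rows ;; edge_footer) (\<lambda>s' t'.
    edges_inv n m E W (p + length l + length r + 2) (out @ X n l r) (ws @ [W (length ws)]) s' \<and>
    t' \<le> t + (9 * length r + 6) * length l + 17) s t"
proof -
  have l: "E p = length l" "holds_list (\<lambda>i. E (Suc (p + i))) l"
    and r: "E (Suc (p + length l)) = length r" "holds_list (\<lambda>i. E (Suc (Suc (p + length l + i)))) r"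
    using lr(1) by (simp_all add: holds_list_append holds_list_Cons add.assoc)
  have s: "ireg s ''n'' = n" "ireg s ''m'' = m" "ireg s ''one'' = 1" "ireg s ''z'' = n * n"
     "ireg s ''out_n'' = n * n + 1" "ireg s ''i'' = length ws" "ireg s ''p'' = p"
     "ireg s ''h'' = length out" "iarr s ''edges'' = E" "rarr s ''weights'' = W"
     "holds_list (iarr s ''out_edges'') out" "holds_list (rarr s ''out_weights'') ws"
    using inv by (simp_all add: edges_inv_def)
  define d where "d = (if set l \<inter> set r = {} then 1 else 0 :: nat)"
  \<comment> \<open>The three writes in program order: the codes, the length cell before them, the
    extra vertex behind them. Together they are one \<open>put\<close> of a block followed by
    \<open>n * n\<close>; if \<open>d = 0\<close>, that last cell is cut off by passing to a
    prefix.\<close>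
  have out: "holds_list (((put a (Suc (length out)) (pair_indices n l r))
      (length out := length l * length r + d))(Suc (length out + length l * length r) := n * n))
      (out @ X n l r)"
    if "holds_list a out" for a
  proof -
    let ?xs = "(length l * length r + d) # pair_indices n l r"
    have "((put a (Suc (length out)) (pair_indices n l r))
        (length out := length l * length r + d))(Suc (length out + length l * length r) := n * n)
      = put a (length out) (?xs @ [n * n])"
      using put_snoc[of a "length out" ?xs "n * n"] by (simp add: put_Cons)
    moreover have "holds_list (put a (length out) (?xs @ [n * n])) (out @ ?xs @ [n * n])"
      using that by (rule holds_list_put)
    moreover from this have "holds_list (put a (length out) (?xs @ [n * n])) (out @ ?xs)"
      using holds_list_append[of _ "out @ ?xs" "[n * n]"] by simp
    ultimately show ?thesis
      by (cases "set l \<inter> set r = {}") (simp_all add: X_def edge_indices_def d_def)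
  qed
  have ws: "holds_list (a(length ws := w)) (ws @ [w])" if "holds_list a ws" for a and w :: real
    using that by (auto simp: holds_list_def nth_append less_Suc_eq)
  show ?thesis
    unfolding edge_header_def wp_simps
    using B
  proof (simp add: s l r, intro wp_mono[OF wp_pair_rows[where l = l and r = r and n = n]], goal_cases)
    \<comment> \<open>The earlier goals are the premises of \<open>wp_pair_rows\<close>; this one
      runs the footer from its postcondition.\<close>
    case (12 s' t')
    then show ?case
      using out[OF s(11)] ws[OF s(12)]
      by (cases "set l \<inter> set r = {}")
        (simp_all add: edge_footer_def agrees_outside_def edges_inv_def s d_def X_def edge_indices_def)
  qed (simp_all add: s l r lr)
qed

lemma length_concat_map_le:
  "(\<And>x. x \<in> set xs \<Longrightarrow> length (f x) \<le> k) \<Longrightarrow> length (concat (map f xs)) \<le> length xs * k"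
  by (induction xs) (auto simp: add_mono)

definition input_code :: "nat list \<times> nat list \<times> real \<Rightarrow> nat list" where
  "input_code = (\<lambda>(l, r, w). (length l # l) @ (length r # r))"

definition output_code :: "nat \<Rightarrow> nat list \<times> nat list \<times> real \<Rightarrow> nat list" where
  "output_code n = (\<lambda>(l, r, w). length (edge_indices n l r) # edge_indices n l r)"

text \<open>List lengths carry two bounds: \<open>k\<close> controls the running time, while
  \<open>n\<close> controls addresses, as input and output blocks have at most
  \<open>2 * n + 2\<close> and \<open>n * n + 2\<close> cells. The 18 is the 17 of
  \<open>wp_edge\<close> plus the loop test.\<close>

lemma wp_edges:
  fixes D :: "(nat list \<times> nat list \<times> real) list" and n :: nat
  defines "inp \<equiv> \<lambda>i. concat (map input_code (take i D))"
    and "outp \<equiv> \<lambda>i. concat (map (output_code n) (take i D))"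
    and "ws \<equiv> \<lambda>i. map (\<lambda>(l, r, w). w) (take i D)"
    and "m \<equiv> length D"
  assumes inv: "edges_inv n m E W 0 [] [] s"
    and E: "holds_list E (concat (map input_code D))"
    and W: "holds_list W (map (\<lambda>(l, r, w). w) D)"
    and D: "\<And>l r w. (l, r, w) \<in> set D \<Longrightarrow>
      set l \<subseteq> {..<n} \<and> set r \<subseteq> {..<n} \<and> length l \<le> min n k \<and> length r \<le> min n k"
    and B: "m * (2 * n + 2) \<le> B" "m * (n * n + 2) \<le> B" "n * n \<le> B"
  shows "wp B (While (ILess ''i'' ''m'') (edge_header ;; pair_rows ;; edge_footer))
    (\<lambda>s' t'. edges_inv n m E W (length (inp m)) (outp m) (ws m) s' \<and>
      t' \<le> t + ((9 * k + 6) * k + 18) * m + 1) s t"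
proof (rule wp_While_upto[where k = m and I = "\<lambda>i s' t'.
    edges_inv n m E W (length (inp i)) (outp i) (ws i) s' \<and> t' \<le> t + ((9 * k + 6) * k + 18) * i"], goal_cases)
  case (2 i s' t')
  obtain l r w where lrw: "D ! i = (l, r, w)" by (cases "D ! i")
  have i: "i < length D" using 2 by (simp add: m_def)
  have mem: "(l, r, w) \<in> set D" using i lrw by (metis nth_mem)
  have take: "take (Suc i) D = take i D @ [(l, r, w)]"
    using i lrw by (simp add: take_Suc_conv_app_nth)
  \<comment> \<open>Splitting \<open>D\<close> around its entry \<open>i\<close> locates the block
    of that hyperedge at offset \<open>length (inp i)\<close>.\<close>
  have "D = take (Suc i) D @ drop (Suc i) D" by simp
  also have "\<dots> = take i D @ [(l, r, w)] @ drop (Suc i) D" unfolding take by simp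
  finally have "holds_list E (inp i @ input_code (l, r, w) @ concat (map input_code (drop (Suc i) D)))"
    using E unfolding inp_def by (metis concat.simps(2) concat_append list.simps(9) map_append append_Cons append_Nil)
  then have Ei: "holds_list (\<lambda>j. E (length (inp i) + j)) (length l # l @ length r # r)"
    unfolding holds_list_append[of _ "inp i"] holds_list_append[of _ "input_code (l, r, w)"]
    by (simp add: input_code_def)
  have ws: "length (ws i) = i" "W i = w"
    using W i lrw by (auto simp: ws_def holds_list_def)
  have len: "length x \<le> min n k" if "x = l \<or> x = r" for x
    using D[OF mem] that by auto
  have "length (inp i) \<le> length (take i D) * (2 * n + 2)"
    unfolding inp_def
  proof (rule length_concat_map_le)
    fix x assume "x \<in> set (take i D)"
    moreover obtain l r w where x: "x = (l, r, w)" by (cases x)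
    ultimately have "(l, r, w) \<in> set D" using in_set_takeD by fast
    from D[OF this] show "length (input_code x) \<le> 2 * n + 2"
      by (simp add: x input_code_def)
  qed
  then have inpB: "length (inp i) \<le> i * (2 * n + 2)" using i by simp
  have "length (outp i) \<le> length (take i D) * (n * n + 2)"
    unfolding outp_def
  proof (rule length_concat_map_le)
    fix x assume "x \<in> set (take i D)"
    moreover obtain l r w where x: "x = (l, r, w)" by (cases x)
    ultimately have "(l, r, w) \<in> set D" using in_set_takeD by fast
    from D[OF this] have "length l * length r \<le> n * n" by (intro mult_mono) auto
    then show "length (output_code n x) \<le> n * n + 2"
      by (simp add: x output_code_def edge_indices_def)
  qed
  then have outpB: "length (outp i) \<le> i * (n * n + 2)" using i by simp
  have lr: "length l * length r \<le> n * n" "length l * length r \<le> k * k"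
    using len by (auto intro!: mult_mono)
  \<comment> \<open>The blocks before \<open>i\<close> together with block \<open>i\<close> fit into
    the space of \<open>m\<close> blocks, which is what \<open>B\<close> bounds.\<close>
  have Suc_le: "Suc i * c \<le> m * c" for c using 2 by (intro mult_right_mono) auto
  have "wp B (edge_header ;; pair_rows ;; edge_footer) (\<lambda>s'' t''.
    edges_inv n m E W (length (inp i) + length l + length r + 2)
      (outp i @ length (edge_indices n l r) # edge_indices n l r) (ws i @ [W (length (ws i))]) s'' \<and>
    t'' \<le> Suc t' + (9 * length r + 6) * length l + 17) s' (Suc t')"
  proof (rule wp_edge)
    show "length (inp i) + length l + length r + 2 \<le> B"
      using inpB Suc_le[of "2 * n + 2"] B(1) len[of l] len[of r] by simp
    show "length (outp i) + length l * length r + 2 \<le> B"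
      using outpB Suc_le[of "n * n + 2"] B(2) lr by simp
    show "length (ws i) < B"
      using Suc_le[of 2] B(2) ws by (simp add: algebra_simps)
  qed (use 2 D[OF mem] B Ei in auto)
  then have "wp B (edge_header ;; pair_rows ;; edge_footer) (\<lambda>s' t'.
    edges_inv n m E W (length (inp (Suc i))) (outp (Suc i)) (ws (Suc i)) s' \<and>
      t' \<le> t + ((9 * k + 6) * k + 18) * Suc i) s' (Suc t')"
  proof (rule wp_mono, goal_cases)
    case (1 s'' t'')
    have "(9 * length r + 6) * length l \<le> (9 * k + 6) * k"
      using len by (intro mult_mono) auto
    then have "t'' \<le> t + ((9 * k + 6) * k + 18) * Suc i" using 1 2 by simp
    moreover have "length (inp (Suc i)) = length (inp i) + length l + length r + 2"
      "outp (Suc i) = outp i @ length (edge_indices n l r) # edge_indices n l r"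
      "ws (Suc i) = ws i @ [W (length (ws i))]"
      using ws by (simp_all add: inp_def outp_def ws_def take input_code_def output_code_def)
    ultimately show ?case using 1 by simp
  qed
  moreover have "ireg s' ''i'' = i" "ireg s' ''m'' = m"
    using 2 ws by (simp_all add: edges_inv_def)
  ultimately show ?case using 2 by simp
next
  case 1
  then show ?case using inv by (simp add: inp_def outp_def ws_def)
next
  case (3 s' t')
  then show ?case by (simp add: edges_inv_def ws_def m_def)
qed

text \<open>Positivity of \<open>k\<close> is asked only for \<open>m > 0\<close>: without
  hyperedges the maximum size is a \<open>Max\<close> over the empty set and has no known
  value.\<close>

lemma wp_hypergraph_program:
  fixes D :: "(nat list \<times> nat list \<times> real) list"
  defines "m \<equiv> length D"
  assumes s: "ireg s ''n'' = n" "ireg s ''m'' = m"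
      "holds_list (iarr s ''edges'') (concat (map input_code D))"
      "holds_list (rarr s ''weights'') (map (\<lambda>(l, r, w). w) D)"
    and D: "\<And>l r w. (l, r, w) \<in> set D \<Longrightarrow>
      set l \<subseteq> {..<n} \<and> set r \<subseteq> {..<n} \<and> length l \<le> min n k \<and> length r \<le> min n k"
    and k: "m > 0 \<Longrightarrow> 1 \<le> k"
    and B: "m * (2 * n + 2) \<le> B" "m * (n * n + 2) \<le> B" "n * n + 1 \<le> B"
  shows "wp B hypergraph_program (\<lambda>s t. ireg s ''out_n'' = n * n + 1 \<and> ireg s ''out_m'' = m \<and>
    holds_list (iarr s ''out_edges'') (concat (map (output_code n) D)) \<and>
    holds_list (rarr s ''out_weights'') (map (\<lambda>(l, r, w). w) D) \<and>
    t \<le> 50 * max 1 (m * k\<^sup>2)) s 0"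
proof -
  \<comment> \<open>Six initial instructions, the loop with its exit test, and the final copy. If
    \<open>m\<close> and \<open>k\<close> are positive, each of \<open>m * k\<close>,
    \<open>m\<close> and 1 is at most \<open>m * (k * k)\<close>, so the sum is at most 9 + 6 + 18 +
    8 = 41 times that.\<close>
  have time: "6 + ((9 * k + 6) * k + 18) * m + 1 + 1 \<le> 50 * max 1 (m * k\<^sup>2)"
  proof (cases "m = 0")
    case False
    then have "1 \<le> m" "1 \<le> k" using k by auto
    then have "k \<le> k * k" "1 \<le> m * (k * k)" by simp_all
    moreover have "m * k \<le> m * (k * k)" "m * 1 \<le> m * (k * k)"
      using \<open>1 \<le> k\<close> by (intro mult_left_mono; simp)+
    moreover have "((9 * k + 6) * k + 18) * m = 9 * (m * (k * k)) + 6 * (m * k) + 18 * m"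
      by (simp add: algebra_simps)
    ultimately show ?thesis unfolding power2_eq_square by linarith
  qed simp
  have "m \<le> B" using B(2) by (simp add: algebra_simps)
  show ?thesis
    unfolding hypergraph_program_def wp_simps
  proof (intro conjI, goal_cases)
    case 7
    show ?case
      unfolding s
    proof (rule wp_mono[OF wp_edges[where D = D and n = n and k = k and B = B and
          E = "iarr s ''edges''" and W = "rarr s ''weights''", folded m_def]], goal_cases)
      case (8 s' t')
      then show ?case using time \<open>m \<le> B\<close> by (simp add: edges_inv_def m_def)
    qed (use s D B in \<open>auto simp: edges_inv_def holds_list_def\<close>)
  qed (use B s in auto)
qed

section \<open>Reading the memory as a hypergraph\<close>

text \<open>The output lists the images in the order of \<open>D\<close>, so the weights carry over
  position by position; injectivity of \<open>pair_edge n\<close> excludes repetitions.\<close>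

lemma output_pair_hypergraph:
  assumes H: "directed_hypergraph H" and D: "lists_dhypergraph n D H"
    and s: "ireg s ''out_n'' = n * n + 1" "ireg s ''out_m'' = length D"
      "holds_list (iarr s ''out_edges'') (concat (map (output_code n) D))"
      "holds_list (rarr s ''out_weights'') (map (\<lambda>(l, r, w). w) D)"
  shows "output_hypergraph (pair_hypergraph H) s"
proof -
  let ?es = "map (\<lambda>(l, r, w). (set l, set r)) D"
  define D' where "D' = map (\<lambda>(l, r, w). (edge_indices n l r, w)) D"
  have n: "dverts H = {..<n}" and es: "distinct ?es" "set ?es = dedges H"
    using D by (simp_all add: lists_dhypergraph_def Let_def)
  have es': "map (\<lambda>(l, w). set l) D' = map (pair_edge n) ?es"
    by (simp add: D'_def set_edge_indices case_prod_beta)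
  have "distinct l' \<and> w' = weight (pair_hypergraph H) (set l')" if l': "(l', w') \<in> set D'" for l' w'
  proof -
    obtain l r w where lrw: "(l, r, w) \<in> set D" "l' = edge_indices n l r" "w' = w"
      using l' by (auto simp: D'_def)
    then have "distinct l" "distinct r" "w = dweight H (set l, set r)"
      using D by (auto simp: lists_dhypergraph_def)
    moreover have e: "(set l, set r) \<in> dedges H" using lrw(1) unfolding es(2)[symmetric] by force
    ultimately show ?thesis
      using lrw directed_hypergraph_edge[OF H e] n
      by (simp add: distinct_edge_indices set_edge_indices pair_hypergraph_simps(3)[OF H n e])
  qed
  then have "lists_hypergraph (n\<^sup>2 + 1) D' (pair_hypergraph H)"
    unfolding lists_hypergraph_def es' Let_def distinct_map[of "pair_edge n"] set_map[of "pair_edge n"] es(2)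
      pair_hypergraph_simps(1,2)[OF H n]
    using es(1) inj_on_pair_edge_dedges[OF H n] by auto
  moreover have "map (\<lambda>(l, w). length l # l) D' = map (output_code n) D"
    "map (\<lambda>(l, w). w) D' = map (\<lambda>(l, r, w). w) D" "length D' = length D"
    by (auto simp: D'_def output_code_def)
  ultimately show ?thesis
    unfolding output_hypergraph_def using s
    by (intro exI[of _ "n\<^sup>2 + 1"] exI[of _ D']) (simp del: map_eq_conv add: power2_eq_square)
qed

lemma hypergraph_map_computable_pair_hypergraph: "hypergraph_map_computable pair_hypergraph"
  unfolding hypergraph_map_computable_def Let_def
proof (rule exI[of _ hypergraph_program], rule exI[of _ 50], rule exI[of _ 3], intro allI impI, elim conjE)
  fix H :: "nat dhypergraph" and s
  assume H: "directed_hypergraph H" and "input_dhypergraph H s"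
  then obtain n D where D: "lists_dhypergraph n D H"
    and s: "ireg s ''n'' = n" "ireg s ''m'' = length D"
      "holds_list (iarr s ''edges'') (concat (map input_code D))"
      "holds_list (rarr s ''weights'') (map (\<lambda>(l, r, w). w) D)"
    unfolding input_dhypergraph_def input_code_def by blast
  let ?es = "map (\<lambda>(l, r, w). (set l, set r)) D"
  define k where "k = max_dedge_size H"
  have n: "dverts H = {..<n}" and es: "distinct ?es" "set ?es = dedges H"
    using D by (simp_all add: lists_dhypergraph_def Let_def)
  have m: "card (dedges H) = length D"
    using distinct_card[OF es(1)] es(2) by simp
  have size_le: "dedge_size e \<le> k" if "e \<in> dedges H" for e
    using that unfolding k_def max_dedge_size_def es(2)[symmetric] by (intro Max_ge) auto
  have D_bound: "set l \<subseteq> {..<n} \<and> set r \<subseteq> {..<n} \<and> length l \<le> min n k \<and> length r \<le> min n k"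
    if lrw: "(l, r, w) \<in> set D" for l r w
  proof -
    have e: "(set l, set r) \<in> dedges H" using lrw unfolding es(2)[symmetric] by force
    have "distinct l" "distinct r" using D lrw by (auto simp: lists_dhypergraph_def)
    then have len: "length l = card (set l)" "length r = card (set r)"
      by (simp_all add: distinct_card)
    have sub: "set l \<subseteq> {..<n}" "set r \<subseteq> {..<n}" using directed_hypergraph_edge[OF H e] n by auto
    have "card (set l) \<le> dedge_size (set l, set r)" "card (set r) \<le> dedge_size (set l, set r)"
      by (auto simp: dedge_size_def intro: card_mono)
    moreover have "card (set l) \<le> n" "card (set r) \<le> n"
      using card_mono[OF _ sub(1)] card_mono[OF _ sub(2)] by auto
    ultimately show ?thesis using sub len size_le[OF e] by auto
  qed
  have k_pos: "1 \<le> k" if "0 < length D"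
  proof -
    have "set ?es \<noteq> {}" using that by auto
    then obtain e where e: "e \<in> dedges H" unfolding es(2) by blast
    have "0 < dedge_size e"
      using directed_hypergraph_edge[OF H e] by (simp add: dedge_size_def card_gt_0_iff)
    then show ?thesis using size_le[OF e] by simp
  qed
  define N where "N = n + length D + 2"
  \<comment> \<open>Each block is bounded by \<open>n * n + 2 * n + 2 \<le> N * N\<close>, and there
    are at most \<open>N\<close> blocks; hence the exponent 3.\<close>
  have B: "length D * (2 * n + 2) \<le> N ^ 3" "length D * (n * n + 2) \<le> N ^ 3" "n * n + 1 \<le> N ^ 3"
  proof -
    have "n * n + 2 * n + 2 \<le> N * N"
    proof -
      have "(n + 2) * (n + 2) \<le> N * N" unfolding N_def by (intro mult_mono) auto
      then show ?thesis by simp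
    qed
    then have "x \<le> N ^ 3" if "x \<le> y * z" "y \<le> N" "z \<le> n * n + 2 * n + 2" for x y z
      using that mult_mono[of y N z "N * N"] by (simp add: power3_eq_cube)
    note * = this
    show "length D * (2 * n + 2) \<le> N ^ 3" "length D * (n * n + 2) \<le> N ^ 3"
      by (rule *[OF order.refl]; simp add: N_def)+
    show "n * n + 1 \<le> N ^ 3"
      by (rule *[of _ 1 "n * n + 1"]) (simp_all add: N_def)
  qed
  have "wp (N ^ 3) hypergraph_program (\<lambda>s t. ireg s ''out_n'' = n * n + 1 \<and> ireg s ''out_m'' = length D \<and>
    holds_list (iarr s ''out_edges'') (concat (map (output_code n) D)) \<and>
    holds_list (rarr s ''out_weights'') (map (\<lambda>(l, r, w). w) D) \<and>
    t \<le> 50 * max 1 (length D * k\<^sup>2)) s 0"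
    using s D_bound k_pos B by (rule wp_hypergraph_program)
  then have "wp (N ^ 3) hypergraph_program (\<lambda>s t. t \<le> 50 * max 1 (length D * k\<^sup>2) \<and>
      output_hypergraph (pair_hypergraph H) s) s 0"
    by (rule wp_mono) (simp add: output_pair_hypergraph[OF H D])
  then show "\<exists>t s'. exec ((card (dverts H) + card (dedges H) + 2) ^ 3) hypergraph_program s t s' \<and>
      t \<le> 50 * max 1 (card (dedges H) * (max_dedge_size H)\<^sup>2) \<and>
      output_hypergraph (pair_hypergraph H) s'"
    unfolding wp_def m N_def k_def by (simp add: n)
qed

theorem theorem1p1:
  "\<exists>(\<psi> :: nat dhypergraph \<Rightarrow> nat hypergraph)
     (\<psi>e :: nat dhypergraph \<Rightarrow> nat dhyperedge \<Rightarrow> nat set)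
     (\<theta> :: nat \<Rightarrow> (nat \<Rightarrow> real) \<Rightarrow> nat \<Rightarrow> real).
     hypergraph_map_computable \<psi> \<and>
     vector_map_computable \<theta> \<and>
     (\<forall>n H. directed_hypergraph H \<and> dverts H = {..<n} \<longrightarrow>
        undirected_hypergraph (\<psi> H) \<and> verts (\<psi> H) = {..<n\<^sup>2 + 1} \<and>
        (\<forall>x. dlaplacian_form H x = laplacian_form (\<psi> H) (\<theta> n x)) \<and>
        bij_betw (\<psi>e H) (dedges H) (edges (\<psi> H)) \<and>
        (\<forall>e\<in>dedges H.
           (\<forall>x. dlaplacian_form (dsingle H e) x
                = laplacian_form (single (\<psi> H) (\<psi>e H e)) (\<theta> n x)) \<and>
           card (\<psi>e H e) \<le> (dedge_size e)\<^sup>2)) \<and>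
     (\<forall>n x. (\<forall>i<n. x i \<in> {0, 1}) \<longrightarrow> (\<forall>i<n\<^sup>2 + 1. \<theta> n x i \<in> {0, 1}))"
\<comment> \<open>The edge map receives only \<open>H\<close>, so it recovers \<open>n\<close> as
  the number of vertices.\<close>
proof (rule exI[of _ pair_hypergraph], rule exI[of _ "\<lambda>H. pair_edge (card (dverts H))"],
    rule exI[of _ pair_vector], intro conjI allI ballI impI; (elim conjE)?)
  show "hypergraph_map_computable pair_hypergraph"
    by (rule hypergraph_map_computable_pair_hypergraph)
  show "vector_map_computable pair_vector"
    by (rule vector_map_computable_pair_vector)
  show "pair_vector n x i \<in> {0, 1}" if "\<forall>i<n. x i \<in> {0, 1}" for n x i
    using that by (rule pair_vector_binary)
next
  fix n and H :: "nat dhypergraph" assume H: "directed_hypergraph H" "dverts H = {..<n}"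
  have card: "card (dverts H) = n" using H by simp
  show "undirected_hypergraph (pair_hypergraph H)"
    using H by (rule undirected_pair_hypergraph)
  show "verts (pair_hypergraph H) = {..<n\<^sup>2 + 1}"
    using H by (rule pair_hypergraph_simps)
  show "bij_betw (pair_edge (card (dverts H))) (dedges H) (edges (pair_hypergraph H))"
    unfolding bij_betw_def card using inj_on_pair_edge_dedges[OF H] pair_hypergraph_simps(2)[OF H] by simp
  \<comment> \<open>Taking all hyperedges for \<open>F\<close>, both record updates replace the edge
    set by itself.\<close>
  show "dlaplacian_form H x = laplacian_form (pair_hypergraph H) (pair_vector n x)" for x
    using laplacian_form_pair_edges[OF H subset_refl, of x] pair_hypergraph_simps(2)[OF H]
    by (metis hypergraph.surjective hypergraph.update_convs(2) dhypergraph.surjective dhypergraph.update_convs(2))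
  fix e assume e: "e \<in> dedges H"
  show "dlaplacian_form (dsingle H e) x
      = laplacian_form (single (pair_hypergraph H) (pair_edge (card (dverts H)) e)) (pair_vector n x)" for x
    using laplacian_form_pair_edges[OF H, of "{e}" x] e by (simp add: dsingle_def single_def card)
  show "card (pair_edge (card (dverts H)) e) \<le> (dedge_size e)\<^sup>2"
    using directed_hypergraph_edge[OF H(1) e] by (intro card_pair_edge)
qed

end
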